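(* For every $n\geq 3$, the simple cycle $C_n$ on $n$ vertices satisfies: (1) $C_n\in\mathfrak{T}$; (2) $w_\tau(C_n)=3$ if $n$ is divisible by $3$, and $w_\tau(C_n)=4$ otherwise; (3) $W_\tau(C_n)=n+2$.
   Context: All graphs are finite, undirected, without loops or multiple edges. A total coloring of a graph $G$ is an assignment of colors to the vertices and edges of $G$ such that no two adjacent vertices, no two adjacent edges, and no vertex and an edge incident to it receive the same color. For a positive integer $t$, an interval total $t$-coloring of $G$ is a total coloring of $G$ with colors $1,2,\ldots,t$ such that each color $i\in\{1,\ldots,t\}$ is used on at least one vertex or edge, and for each vertex $v$ the set consisting of the color of $v$ and the colors of the edges incident to $v$ consists of $d_G(v)+1$ consecutive integers, where $d_G(v)$ is the degree of $v$. $\mathfrak{T}_t$ denotes the set of graphs having an interval total $t$-coloring, and $\mathfrak{T}=\bigcup_{t\geq 1}\mathfrak{T}_t$. For $G\in\mathfrak{T}$, $w_\tau(G)$ and $W_\tau(G)$ denote the least and the greatest $t$ such that $G\in\mathfrak{T}_t$. *)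

theory Defs
  imports Main
begin

record 'v graph =
  verts :: "'v set"
  edges :: "'v set set"

definition simple_graph :: "'v graph \<Rightarrow> bool" where
  "simple_graph G \<longleftrightarrow> finite (verts G) \<and> (\<forall>e \<in> edges G. e \<subseteq> verts G \<and> card e = 2)"

definition incident_edges :: "'v graph \<Rightarrow> 'v \<Rightarrow> 'v set set" where
  "incident_edges G v = {e \<in> edges G. v \<in> e}"

definition degree :: "'v graph \<Rightarrow> 'v \<Rightarrow> nat" where
  "degree G v = card (incident_edges G v)"

text \<open>A coloring of the vertices and edges is given by a pair of functions: \<open>f\<close> colors the
  vertices and \<open>h\<close> colors the edges. Only their values on \<open>verts G\<close> and \<open>edges G\<close> matter.\<close>

definition total_coloring :: "'v graph \<Rightarrow> ('v \<Rightarrow> nat) \<Rightarrow> ('v set \<Rightarrow> nat) \<Rightarrow> bool" where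
  "total_coloring G f h \<longleftrightarrow>
     (\<forall>u \<in> verts G. \<forall>v \<in> verts G. {u, v} \<in> edges G \<longrightarrow> f u \<noteq> f v) \<and>
     (\<forall>e \<in> edges G. \<forall>e' \<in> edges G. e \<noteq> e' \<and> e \<inter> e' \<noteq> {} \<longrightarrow> h e \<noteq> h e') \<and>
     (\<forall>v \<in> verts G. \<forall>e \<in> edges G. v \<in> e \<longrightarrow> f v \<noteq> h e)"

text \<open>The equation with \<open>{1..t}\<close> says both that all colors lie in \<open>{1..t}\<close> and that each of
  them is used; \<open>{a..a + degree G v}\<close> is a block of \<open>degree G v + 1\<close> consecutive integers.\<close>

definition interval_total_coloring ::
  "'v graph \<Rightarrow> nat \<Rightarrow> ('v \<Rightarrow> nat) \<Rightarrow> ('v set \<Rightarrow> nat) \<Rightarrow> bool" where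
  "interval_total_coloring G t f h \<longleftrightarrow>
     total_coloring G f h \<and>
     f ` verts G \<union> h ` edges G = {1..t} \<and>
     (\<forall>v \<in> verts G. \<exists>a. insert (f v) (h ` incident_edges G v) = {a..a + degree G v})"

definition interval_total_colorable_with :: "nat \<Rightarrow> 'v graph set" where
  "interval_total_colorable_with t =
     {G. simple_graph G \<and> t \<ge> 1 \<and> (\<exists>f h. interval_total_coloring G t f h)}"

definition interval_total_colorable :: "'v graph set" where
  "interval_total_colorable = (\<Union>t \<in> {1..}. interval_total_colorable_with t)"

text \<open>The two parameters below are meaningful for graphs in \<open>interval_total_colorable\<close>: the set
  of admissible \<open>t\<close> is then nonempty, and it is always bounded, since every color is used.\<close>

lemma interval_total_colorable_with_bound:
  assumes "G \<in> interval_total_colorable_with t"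
  shows "t \<le> card (verts G) + card (edges G)"
proof -
  from assms obtain f h where G: "simple_graph G" and
      eq: "f ` verts G \<union> h ` edges G = {1..t}"
    by (auto simp: interval_total_colorable_with_def interval_total_coloring_def)
  have fin: "finite (verts G)" using G by (simp add: simple_graph_def)
  have "edges G \<subseteq> Pow (verts G)" using G by (auto simp: simple_graph_def)
  then have finE: "finite (edges G)" using fin finite_subset by blast
  have "t = card (f ` verts G \<union> h ` edges G)" by (simp add: eq)
  also have "\<dots> \<le> card (f ` verts G) + card (h ` edges G)" by (rule card_Un_le)
  also have "\<dots> \<le> card (verts G) + card (edges G)"
    using fin finE by (intro add_mono card_image_le)
  finally show ?thesis .
qed

definition w_tau :: "'v graph \<Rightarrow> nat" where
  "w_tau G = (LEAST t. G \<in> interval_total_colorable_with t)"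

definition W_tau :: "'v graph \<Rightarrow> nat" where
  "W_tau G = (GREATEST t. G \<in> interval_total_colorable_with t)"

text \<open>This is the simple cycle on \<open>n\<close> vertices only when \<open>n \<ge> 3\<close>.\<close>

definition cycle_graph :: "nat \<Rightarrow> nat graph" where
  "cycle_graph n = \<lparr>verts = {0..<n}, edges = {{i, (i + 1) mod n} | i. i < n}\<rparr>"

end

theory Submission
  imports Defs
begin

text \<open>Write \<open>a i\<close> for the color of vertex \<open>i\<close> and \<open>b i\<close> for the color of the edge from \<open>i\<close> to
  \<open>i + 1\<close>, indices modulo \<open>n\<close>. The coloring condition is that \<open>b i, a (i + 1), b (i + 1)\<close> are three
  consecutive integers in some order and that adjacent vertices have distinct colors.

  With three colors only, any three successive terms of \<open>a 0, b 0, a 1, b 1, \<dots>\<close> are distinct, so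
  this cyclic sequence of length \<open>2 n\<close> has period 3, and 3 divides \<open>n\<close>.

  For the upper bound \<open>t \<le> n + 2\<close>, take a vertex whose colors include 1 and one whose colors
  include \<open>t\<close>. The edge colors at the first sum to at most 5, those at the second to at least
  \<open>2 t - 3\<close>. Successive edge colors differ by at most 2 and the two arcs joining the two vertices
  comprise \<open>n - 2\<close> steps between edges, so \<open>2 t - 3 - 5 \<le> 2 (n - 2)\<close>.\<close>

section \<open>Edges, incidence and degrees in the cycle\<close>

definition cycle_edge :: "nat \<Rightarrow> nat \<Rightarrow> nat set" where
  "cycle_edge n i = {i, Suc i mod n}"

lemma verts_cycle_graph [simp]: "verts (cycle_graph n) = {..<n}"
  by (auto simp: cycle_graph_def)

lemma edges_cycle_graph: "edges (cycle_graph n) = cycle_edge n ` {..<n}"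
  by (auto simp: cycle_graph_def cycle_edge_def)

lemma Suc_mod_cycle: "i < n \<Longrightarrow> Suc i mod n = (if Suc i = n then 0 else Suc i)"
  by auto

text \<open>For \<open>n = 2\<close> the indices 0 and 1 would name the same edge. From
  \<open>n = 3\<close> on the index is determined by the edge, so edge colors can be given by
  index.\<close>

lemma inj_on_cycle_edge:
  assumes "n \<ge> 3"
  shows "inj_on (cycle_edge n) {..<n}"
proof (rule inj_onI)
  fix i j assume "i \<in> {..<n}" "j \<in> {..<n}" "cycle_edge n i = cycle_edge n j"
  then show "i = j"
    using assms by (auto simp: cycle_edge_def Suc_mod_cycle doubleton_eq_iff split: if_splits)
qed

lemma simple_graph_cycle_graph:
  assumes "n \<ge> 3"
  shows "simple_graph (cycle_graph n)"
  using assms by (auto simp: simple_graph_def edges_cycle_graph cycle_edge_def Suc_mod_cycle)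

lemma incident_edges_cycle_graph:
  assumes "n \<ge> 3" "i < n"
  shows "incident_edges (cycle_graph n) (Suc i mod n) = {cycle_edge n i, cycle_edge n (Suc i mod n)}"
proof -
  have "Suc i mod n \<in> cycle_edge n j \<longleftrightarrow> j = i \<or> j = Suc i mod n" if "j < n" for j
    using assms that by (auto simp: cycle_edge_def Suc_mod_cycle split: if_splits)
  moreover have "Suc i mod n < n"
    using assms by simp
  ultimately show ?thesis
    using assms by (auto simp: incident_edges_def edges_cycle_graph)
qed

lemma degree_cycle_graph:
  assumes "n \<ge> 3" "i < n"
  shows "degree (cycle_graph n) (Suc i mod n) = 2"
proof -
  have "cycle_edge n i \<noteq> cycle_edge n (Suc i mod n)"
    using inj_on_cycle_edge[OF assms(1)] assms
    by (auto simp: inj_on_eq_iff Suc_mod_cycle)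
  then show ?thesis
    using assms by (simp add: degree_def incident_edges_cycle_graph)
qed

text \<open>Carries facts stated at \<open>Suc i mod n\<close> to every vertex, avoiding
  predecessors modulo \<open>n\<close>.\<close>

lemma less_mod_Suc_cases:
  assumes "v < n"
  obtains i where "i < n" "v = Suc i mod n"
proof (cases v)
  case 0
  with assms that[of "n - 1"] show ?thesis by simp
next
  case (Suc i)
  with assms that[of i] show ?thesis by simp
qed

section \<open>Reduction to pairs of cyclic sequences\<close>

text \<open>Three consecutive integers are distinct, so the block condition already contains the
  edge-edge and vertex-edge conditions; only adjacent vertices get a separate clause.\<close>

definition cycle_coloring :: "nat \<Rightarrow> nat \<Rightarrow> (nat \<Rightarrow> nat) \<Rightarrow> (nat \<Rightarrow> nat) \<Rightarrow> bool" where
  "cycle_coloring n t a b \<longleftrightarrow>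
     (\<forall>i<n. a i \<noteq> a (Suc i mod n)) \<and>
     (\<forall>i<n. \<exists>s. {a (Suc i mod n), b i, b (Suc i mod n)} = {s..s + 2}) \<and>
     a ` {..<n} \<union> b ` {..<n} = {1..t}"

text \<open>Replaces the existential by linear constraints fit for arithmetic. From right to left,
  the three numbers lie in the window starting at their minimum and fill it by cardinality.\<close>

lemma consecutive_iff:
  "(\<exists>s. {x, y, z} = {s..s + (2::nat)}) \<longleftrightarrow>
     x \<noteq> y \<and> x \<noteq> z \<and> y \<noteq> z \<and>
     x \<le> y + 2 \<and> y \<le> x + 2 \<and> x \<le> z + 2 \<and> z \<le> x + 2 \<and> y \<le> z + 2 \<and> z \<le> y + 2"
  (is "?L \<longleftrightarrow> ?R")
proof
  assume ?L
  then obtain s where s: "{x, y, z} = {s..s + 2}" ..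
  have "card {x, y, z} = 3"
    by (simp add: s)
  moreover have "x \<in> {s..s + 2}" "y \<in> {s..s + 2}" "z \<in> {s..s + 2}"
    unfolding s[symmetric] by simp_all
  ultimately show ?R
    by (auto simp: card_insert_if split: if_splits)
next
  assume R: ?R
  define s where "s = min x (min y z)"
  have "{x, y, z} = {s..s + 2}"
  proof (rule card_subset_eq)
    show "{x, y, z} \<subseteq> {s..s + 2}"
      using R by (auto simp: s_def)
    show "card {x, y, z} = card {s..s + 2}"
      using R by simp
  qed simp
  then show ?L ..
qed

lemma consecutive_distinct:
  assumes "\<exists>s. {x, y, z} = {s..s + (2::nat)}"
  shows "x \<noteq> y" "x \<noteq> z" "y \<noteq> z"
  using assms unfolding consecutive_iff by blast+

lemma interval_total_coloring_cycleI:
  assumes n: "n \<ge> 3" and c: "cycle_coloring n t a b"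
  shows "interval_total_coloring (cycle_graph n) t a (b \<circ> the_inv_into {..<n} (cycle_edge n))"
    (is "interval_total_coloring ?G t a ?h")
proof -
  have h: "?h (cycle_edge n i) = b i" if "i < n" for i
    using the_inv_into_f_f[OF inj_on_cycle_edge[OF n]] that by simp
  have hi: "?h ` incident_edges ?G (Suc i mod n) = {b i, b (Suc i mod n)}" if "i < n" for i
    using h[OF that] h[of "Suc i mod n"] that
    by (simp add: incident_edges_cycle_graph[OF n that] del: o_apply)
  have blk: "\<exists>s. {a (Suc i mod n), b i, b (Suc i mod n)} = {s..s + 2}" if "i < n" for i
    using c that by (auto simp: cycle_coloring_def)
  have vert: "a u \<noteq> a v" if uv: "u < n" "v < n" "{u, v} \<in> edges ?G" for u v
  proof -
    obtain i where "i < n" "{u, v} = {i, Suc i mod n}"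
      using uv by (auto simp: edges_cycle_graph cycle_edge_def)
    then show ?thesis
      using c by (metis cycle_coloring_def doubleton_eq_iff)
  qed
  have edge: "?h e \<noteq> ?h e'"
    if e: "e \<in> edges ?G" "e' \<in> edges ?G" "e \<noteq> e'" "v \<in> e" "v \<in> e'" for e e' v
  proof -
    have "v < n"
      using e n by (auto simp: edges_cycle_graph cycle_edge_def)
    then obtain i where i: "i < n" "v = Suc i mod n"
      by (rule less_mod_Suc_cases)
    have "e \<in> incident_edges ?G v" "e' \<in> incident_edges ?G v"
      using e by (auto simp: incident_edges_def)
    \<comment> \<open>Only two edges meet at \<open>v\<close>, so two distinct edges there are these
      two up to order.\<close>
    then have "{e, e'} = {cycle_edge n i, cycle_edge n (Suc i mod n)}"
      using e(3) by (auto simp: i incident_edges_cycle_graph[OF n i(1)])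
    moreover have "b i \<noteq> b (Suc i mod n)"
      using blk[OF i(1)] consecutive_distinct by blast
    moreover have "Suc i mod n < n"
      using n by simp
    ultimately show ?thesis
      using h[OF i(1)] h[of "Suc i mod n"] by (metis doubleton_eq_iff)
  qed
  have vert_edge: "a v \<noteq> ?h e" if e: "v < n" "e \<in> edges ?G" "v \<in> e" for v e
  proof -
    obtain i where i: "i < n" "v = Suc i mod n"
      using e(1) by (rule less_mod_Suc_cases)
    have "?h e \<in> {b i, b (Suc i mod n)}"
      using e hi[OF i(1)] by (auto simp: i(2) incident_edges_def)
    then show ?thesis
      using blk[OF i(1)] consecutive_distinct i(2) by (metis empty_iff insert_iff)
  qed
  have "total_coloring ?G a ?h"
    unfolding total_coloring_def 
  proof (intro conjI ballI impI)
    fix e e' assume e: "e \<in> edges ?G" "e' \<in> edges ?G" "e \<noteq> e' \<and> e \<inter> e' \<noteq> {}"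
    then obtain v where "v \<in> e" "v \<in> e'"
      by auto
    with e show "?h e \<noteq> ?h e'"
      by (intro edge) auto
  qed (use vert vert_edge in \<open>auto simp del: o_apply\<close>)
  moreover have "?h ` edges ?G = b ` {..<n}"
    unfolding edges_cycle_graph image_image using h by (intro image_cong) auto
  moreover have "\<exists>s. insert (a v) (?h ` incident_edges ?G v) = {s..s + degree ?G v}" if v: "v < n" for v
  proof -
    obtain i where i: "i < n" "v = Suc i mod n"
      using v by (rule less_mod_Suc_cases)
    show ?thesis
      unfolding i(2) hi[OF i(1)] degree_cycle_graph[OF n i(1)] using blk[OF i(1)] by simp
  qed
  ultimately show ?thesis
    using c by (simp add: interval_total_coloring_def cycle_coloring_def)
qed

lemma cycle_coloring_of_interval_total_coloring:
  assumes n: "n \<ge> 3" and c: "interval_total_coloring (cycle_graph n) t f h"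
  shows "cycle_coloring n t f (h \<circ> cycle_edge n)"
proof -
  have "f i \<noteq> f (Suc i mod n)" if "i < n" for i
  proof -
    have "{i, Suc i mod n} \<in> edges (cycle_graph n)"
      using that by (auto simp: edges_cycle_graph cycle_edge_def)
    then show ?thesis
      using c that by (simp add: interval_total_coloring_def total_coloring_def)
  qed
  moreover have "\<exists>s. {f (Suc i mod n), h (cycle_edge n i), h (cycle_edge n (Suc i mod n))} = {s..s + 2}"
    if "i < n" for i
  proof -
    have "Suc i mod n \<in> verts (cycle_graph n)"
      using n by simp
    then have "\<exists>s. insert (f (Suc i mod n)) (h ` incident_edges (cycle_graph n) (Suc i mod n)) =
        {s..s + degree (cycle_graph n) (Suc i mod n)}"
      using c unfolding interval_total_coloring_def by blast
    then show ?thesis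
      unfolding incident_edges_cycle_graph[OF n that] degree_cycle_graph[OF n that] by simp
  qed
  moreover have "f ` {..<n} \<union> (h \<circ> cycle_edge n) ` {..<n} = {1..t}"
    using c by (simp add: interval_total_coloring_def edges_cycle_graph image_comp)
  ultimately show ?thesis
    by (simp add: cycle_coloring_def)
qed

lemma cycle_graph_colorable_with_iff:
  assumes "n \<ge> 3"
  shows "cycle_graph n \<in> interval_total_colorable_with t \<longleftrightarrow> t \<ge> 1 \<and> (\<exists>a b. cycle_coloring n t a b)"
  using interval_total_coloring_cycleI[OF assms] cycle_coloring_of_interval_total_coloring[OF assms]
    simple_graph_cycle_graph[OF assms]
  unfolding interval_total_colorable_with_def by blast

section \<open>Constructions with 3, 4 and \<open>n + 2\<close> colors\<close>

lemma cycle_coloring_3: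
  assumes "n \<ge> 3" "3 dvd n"
  shows "\<exists>a b. cycle_coloring n 3 a b"
proof -
  \<comment> \<open>The interleaved sequence \<open>a 0, b 0, a 1, b 1, ...\<close> is 1, 2, 3, 1,
    2, 3, and so on.\<close>
  define a b :: "nat \<Rightarrow> nat" where
    "a i = (if i mod 3 = 0 then 1 else if i mod 3 = 1 then 3 else 2)" and
    "b i = (if i mod 3 = 0 then 2 else if i mod 3 = 1 then 1 else 3)" for i
  have "i mod 3 = 0 \<and> Suc i mod n mod 3 = 1 \<or> i mod 3 = 1 \<and> Suc i mod n mod 3 = 2 \<or>
      i mod 3 = 2 \<and> Suc i mod n mod 3 = 0" if "i < n" for i
  proof -
    \<comment> \<open>Since 3 divides \<open>n\<close>, the pattern also fits where index
      \<open>n - 1\<close> wraps to 0.\<close>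
    have "Suc i mod n mod 3 = Suc i mod 3"
      using assms(2) by (rule mod_mod_cancel)
    moreover have "i mod 3 < 3"
      by simp
    ultimately show ?thesis
      by (auto simp: mod_Suc)
  qed
  then have local: "a i \<noteq> a (Suc i mod n)" "\<exists>s. {a (Suc i mod n), b i, b (Suc i mod n)} = {s..s + 2}"
    if "i < n" for i
    using that unfolding consecutive_iff by (fastforce simp: a_def b_def)+
  have "c \<in> a ` {..<n} \<union> b ` {..<n}" if "c \<in> {1..3}" for c
  proof -
    have "c = b 0 \<or> c = b 1 \<or> c = b 2"
      using that by (auto simp: b_def)
    then show ?thesis
      using assms by force
  qed
  moreover have "a i \<in> {1..3}" "b i \<in> {1..3}" for i
    by (auto simp: a_def b_def)
  ultimately have "a ` {..<n} \<union> b ` {..<n} = {1..3}"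
    by blast
  with local have "cycle_coloring n 3 a b"
    unfolding cycle_coloring_def by blast
  then show ?thesis
    by blast
qed

lemma cycle_coloring_4:
  assumes "n \<ge> 3"
  shows "\<exists>a b. cycle_coloring n 4 a b"
proof (cases "even n")
  case True
  \<comment> \<open>Edges alternate between 2 and 3; either 1 or 4 completes each block, so the
    vertices can alternate too.\<close>
  define a b :: "nat \<Rightarrow> nat" where
    "a i = (if even i then 1 else 4)" and
    "b i = (if even i then 2 else 3)" for i
  have "c \<in> a ` {..<n} \<union> b ` {..<n}" if "c \<in> {1..4}" for c
  proof -
    have "c = a 0 \<or> c = b 0 \<or> c = b 1 \<or> c = a 1"
      using that by (auto simp: a_def b_def)
    then show ?thesis
      using assms by force
  qed
  moreover have "a i \<in> {1..4}" "b i \<in> {1..4}" for i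
    by (auto simp: a_def b_def)
  ultimately have "a ` {..<n} \<union> b ` {..<n} = {1..4}"
    by blast
  then have "cycle_coloring n 4 a b"
    unfolding cycle_coloring_def consecutive_iff
    using assms True by (auto simp: Suc_mod_cycle a_def b_def)
  then show ?thesis
    by blast
next
  case False
  \<comment> \<open>On an odd cycle the edges cannot alternate, so edge 0 gets color 1. Its ends see
    the edge colors 3, 1 and 1, 2 and take 2 and 3; the other vertices alternate between 4 and
    1.\<close>
  define a b :: "nat \<Rightarrow> nat" where
    "a i = (if i = 0 then 2 else if i = 1 then 3 else if even i then 4 else 1)" and
    "b i = (if i = 0 then 1 else if even i then 3 else 2)" for i
  have "c \<in> a ` {..<n} \<union> b ` {..<n}" if "c \<in> {1..4}" for c
  proof -
    have "c = b 0 \<or> c = b 1 \<or> c = b 2 \<or> c = a 2"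
      using that by (auto simp: a_def b_def)
    then show ?thesis
      using assms by force
  qed
  moreover have "a i \<in> {1..4}" "b i \<in> {1..4}" for i
    by (auto simp: a_def b_def)
  ultimately have "a ` {..<n} \<union> b ` {..<n} = {1..4}"
    by blast
  then have "cycle_coloring n 4 a b"
    unfolding cycle_coloring_def consecutive_iff
    using assms False by (auto simp: Suc_mod_cycle a_def b_def)
  then show ?thesis
    by blast
qed

lemma cycle_coloring_max:
  assumes "n \<ge> 3"
  shows "\<exists>a b. cycle_coloring n (n + 2) a b"
proof -
  \<comment> \<open>The edge colors climb through the even numbers and return through the odd ones.\<close>
  define a b :: "nat \<Rightarrow> nat" where
    "a i = (if i = 0 then 1 else if 2 * i < n then 2 * i + 1
       else if 2 * i = n + 1 then n + 2 else 2 * n + 2 - 2 * i)" and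
    "b i = (if 2 * i < n then 2 * i + 2 else 2 * n + 1 - 2 * i)" for i
  have "c \<in> a ` {..<n} \<union> b ` {..<n}" if c: "c \<in> {1..n + 2}" for c
  proof -
    \<comment> \<open>The edges supply all colors from 2 to \<open>n + 1\<close>; the two extreme
      colors come from vertices.\<close>
    consider "c = 1" | "c = n + 2" | "1 < c" "c < n + 2" "even c" | "1 < c" "c < n + 2" "odd c"
      using c by fastforce
    then show ?thesis
    proof cases
      case 1
      then have "c = a 0" by (simp add: a_def)
      then show ?thesis using assms by auto
    next
      case 2
      \<comment> \<open>This is the vertex where the climb turns into the descent. For odd
        \<open>n\<close> the descending formula would give \<open>n + 1\<close> here, the color of
        the edge before it, hence the extra case in \<open>a\<close>.\<close>
      then have "c = a ((n + 1) div 2)"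
        using assms by (auto simp: a_def elim!: oddE)
      moreover have "(n + 1) div 2 < n"
        using assms by auto
      ultimately show ?thesis by blast
    next
      case 3
      then have "c = b (c div 2 - 1)" "c div 2 - 1 < n"
        by (auto simp: b_def elim!: evenE)
      then show ?thesis by blast
    next
      case 4
      then obtain k where "c = 2 * k + 1"
        by (auto elim: oddE)
      then have "c = b (n - k)" "n - k < n"
        using 4 by (auto simp: b_def)
      then show ?thesis by blast
    qed
  qed
  moreover have "a i \<in> {1..n + 2}" "b i \<in> {1..n + 2}" if "i < n" for i
    using that by (auto simp: a_def b_def)
  ultimately have "a ` {..<n} \<union> b ` {..<n} = {1..n + 2}"
    by blast
  then have "cycle_coloring n (n + 2) a b"
    unfolding cycle_coloring_def consecutive_iff
    using assms by (auto simp: Suc_mod_cycle a_def b_def; presburger)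
  then show ?thesis
    by blast
qed

section \<open>Bounds on the number of colors\<close>

text \<open>Reads the coloring as \<open>n\<close>-periodic sequences on all naturals, so that later
  arguments can run past \<open>n\<close>.\<close>

lemma cycle_coloring_mod:
  assumes c: "cycle_coloring n t a b" and n: "n > 0"
  shows "a (k mod n) \<noteq> a (Suc k mod n)"
    and "\<exists>s. {a (Suc k mod n), b (k mod n), b (Suc k mod n)} = {s..s + 2}"
    and "a (k mod n) \<in> {1..t}" "b (k mod n) \<in> {1..t}"
proof -
  have k: "k mod n < n"
    using n by simp
  then show "a (k mod n) \<noteq> a (Suc k mod n)"
    "\<exists>s. {a (Suc k mod n), b (k mod n), b (Suc k mod n)} = {s..s + 2}"
    using c unfolding cycle_coloring_def by (metis mod_Suc_eq)+
  show "a (k mod n) \<in> {1..t}" "b (k mod n) \<in> {1..t}"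
    using c k unfolding cycle_coloring_def by blast+
qed

lemma cycle_coloring_ge_3:
  assumes c: "cycle_coloring n t a b" and n: "n > 0"
  shows "t \<ge> 3"
proof -
  have "a (1 mod n) \<in> {1..t}" "b (0 mod n) \<in> {1..t}" "b (1 mod n) \<in> {1..t}"
    using cycle_coloring_mod(3,4)[OF c n] by blast+
  moreover have "a (1 mod n) \<noteq> b (0 mod n)" "a (1 mod n) \<noteq> b (1 mod n)" "b (0 mod n) \<noteq> b (1 mod n)"
    using consecutive_distinct[OF cycle_coloring_mod(2)[OF c n, of 0]] by simp_all
  ultimately show ?thesis
    by auto
qed

lemma cycle_coloring_3_imp_dvd:
  assumes c: "cycle_coloring n 3 a b" and n: "n > 0"
  shows "3 dvd n"
proof (rule ccontr)
  assume ndvd: "\<not> 3 dvd n"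
  define A B where "A k = a (k mod n)" and "B k = b (k mod n)" for k
  have neq: "A k \<noteq> A (Suc k)" "A (Suc k) \<noteq> B k" "A (Suc k) \<noteq> B (Suc k)" "B k \<noteq> B (Suc k)" for k
    using cycle_coloring_mod(1)[OF c n] consecutive_distinct[OF cycle_coloring_mod(2)[OF c n]]
    by (auto simp: A_def B_def)
  have rng: "A k \<in> {1..3}" "B k \<in> {1..3}" for k
    using cycle_coloring_mod(3,4)[OF c n] by (auto simp: A_def B_def)
  \<comment> \<open>Among three colors, only one differs from two given distinct ones.\<close>
  have third: "w = x"
    if "x \<in> {1..3}" "y \<in> {1..3}" "z \<in> {1..3}" "w \<in> {1..3}" "x \<noteq> y" "x \<noteq> z" "y \<noteq> z" "w \<noteq> y" "w \<noteq> z"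
    for w x y z :: nat
    using that by auto
  have edge: "B (Suc (Suc k)) = A (Suc k)" for k
    using neq[of k] neq[of "Suc k"] rng
    by (intro third[where y = "B (Suc k)" and z = "A (Suc (Suc k))"]; metis)
  have vert: "A (Suc (Suc k)) = B k" for k
    using neq[of k] neq[of "Suc k"] rng
    by (intro third[where y = "A (Suc k)" and z = "B (Suc k)"]; metis)
  have step: "B (k + 3) = B k" for k
    using edge[of "Suc k"] vert[of k] by (simp add: numeral_3_eq_3)
  have period: "B (k + 3 * m) = B k" for k m
  proof (induction m)
    case (Suc m)
    then show ?case
      using step[of "k + 3 * m"] by (simp add: add_ac)
  qed simp
  have "B n = B 0"
    by (simp add: B_def)
  moreover have "B n = B (n mod 3)"
    using period[of "n mod 3" "n div 3"] by simp
  moreover have "n mod 3 = 1 \<or> n mod 3 = 2"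
    using ndvd by presburger
  ultimately have "B 0 = B 1 \<or> B 0 = B 2"
    by auto
  \<comment> \<open>\<open>B 0 = B 2\<close> is refuted through \<open>B 3 = B 0\<close>, as edges 2
    and 3 are consecutive.\<close>
  then show False
    using neq(4)[of 0] neq(4)[of 2] step[of 0] by auto
qed

lemma cycle_coloring_le:
  assumes c: "cycle_coloring n t a b" and n: "n > 0"
  shows "t \<le> n + 2"
proof -
  define A B where "A k = a (k mod n)" and "B k = b (k mod n)" for k
  have blk: "\<exists>s. {A (Suc k), B k, B (Suc k)} = {s..s + 2}" for k
    using cycle_coloring_mod(2)[OF c n] by (simp add: A_def B_def)
  have B_step: "B (k + m) \<le> B k + 2 * m" "B k \<le> B (k + m) + 2 * m" for k m
  proof (induction m)
    case (Suc m)
    then show "B (k + Suc m) \<le> B k + 2 * Suc m" "B k \<le> B (k + Suc m) + 2 * Suc m"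
      using blk[of "k + m"] unfolding consecutive_iff by simp_all
  qed simp_all
  have per: "A (k + n) = A k" "B (k + n) = B k" for k
    by (simp_all add: A_def B_def)
  have ex: "\<exists>k<n. x \<in> {A (Suc k), B k, B (Suc k)}" if x: "x \<in> {1..t}" for x
  proof -
    obtain v where v: "v < n" "x = a v \<or> x = b v"
      using c x unfolding cycle_coloring_def by blast
    then obtain k where "k < n" "v = Suc k mod n"
      using less_mod_Suc_cases by blast
    with v show ?thesis
      by (auto simp: A_def B_def)
  qed
  have t: "t \<ge> 3"
    using cycle_coloring_ge_3[OF c n] .
  then obtain i where i: "i < n" "1 \<in> {A (Suc i), B i, B (Suc i)}"
    using ex[of 1] by auto
  obtain j0 where j0: "j0 < n" "t \<in> {A (Suc j0), B j0, B (Suc j0)}"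
    using ex[of t] t by auto
  \<comment> \<open>Shifting by \<open>n\<close> if necessary puts \<open>j\<close> at or after
    \<open>i\<close>, so that the arcs run from \<open>i\<close> to \<open>j\<close> and from
    \<open>j\<close> to \<open>i + n\<close>.\<close>
  obtain j where j: "i \<le> j" "j < i + n" "t \<in> {A (Suc j), B j, B (Suc j)}"
  proof (cases "i \<le> j0")
    case True
    then show ?thesis
      using j0 that[of j0] by simp
  next
    case False
    then show ?thesis
      using i j0 that[of "j0 + n"] per(1)[of "Suc j0"] per(2)[of "Suc j0"] per(2)[of j0] by simp
  qed
  show ?thesis
  proof (cases "i = j")
    case True
    \<comment> \<open>One block contains both 1 and \<open>t\<close>, so \<open>t\<close> is at most
      3.\<close>
    then show ?thesis
      using i(2) j(3) blk[of i] n unfolding consecutive_iff by auto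
  next
    case False
    \<comment> \<open>Two distinct edge colors in a block containing 1 are at most 2 and 3; in a
      block containing \<open>t\<close> they are at least \<open>t - 2\<close> and
      \<open>t - 1\<close>.\<close>
    have low: "B i + B (Suc i) \<le> 5"
      using i(2) blk[of i] unfolding consecutive_iff by auto
    have high: "2 * t \<le> B j + B (Suc j) + 3"
      using j(3) blk[of j] unfolding consecutive_iff by auto
    \<comment> \<open>The arcs have \<open>j - i - 1\<close> and \<open>n + i - j - 1\<close> steps
      between edges; as \<open>i < j < i + n\<close>, neither subtraction truncates.\<close>
    have "B j \<le> B (Suc i) + 2 * (j - Suc i)"
      using B_step(1)[of "Suc i" "j - Suc i"] j(1) False by simp
    moreover have "B (Suc j) \<le> B i + 2 * (n + i - Suc j)"
    proof -
      have "Suc j + (n + i - Suc j) = i + n"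
        using j(2) by simp
      then show ?thesis
        using B_step(2)[of "Suc j" "n + i - Suc j"] per(2)[of i] by metis
    qed
    ultimately show ?thesis
      using low high j False by linarith
  qed
qed

theorem theorem8:
  fixes n :: nat
  assumes "n \<ge> 3"
  shows "cycle_graph n \<in> interval_total_colorable
    \<and> w_tau (cycle_graph n) = (if 3 dvd n then 3 else 4)
    \<and> W_tau (cycle_graph n) = n + 2"
proof (intro conjI)
  note iff = cycle_graph_colorable_with_iff[OF assms]
  have n: "n > 0"
    using assms by simp
  have max: "cycle_graph n \<in> interval_total_colorable_with (n + 2)"
    using cycle_coloring_max[OF assms] by (simp add: iff)
  then show "cycle_graph n \<in> interval_total_colorable"
    unfolding interval_total_colorable_def by force
  show "W_tau (cycle_graph n) = n + 2"
    unfolding W_tau_def using max cycle_coloring_le[OF _ n] by (intro Greatest_equality) (auto simp: iff)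
  show "w_tau (cycle_graph n) = (if 3 dvd n then 3 else 4)"
    unfolding w_tau_def
  proof (rule Least_equality)
    show "cycle_graph n \<in> interval_total_colorable_with (if 3 dvd n then 3 else 4)"
      using cycle_coloring_3[OF assms] cycle_coloring_4[OF assms] by (simp add: iff)
  next
    fix t assume "cycle_graph n \<in> interval_total_colorable_with t"
    then obtain a b where c: "cycle_coloring n t a b"
      by (auto simp: iff)
    have "t \<ge> 3" "t = 3 \<Longrightarrow> 3 dvd n"
      using cycle_coloring_ge_3[OF c n] cycle_coloring_3_imp_dvd[OF _ n] c by auto
    then show "(if 3 dvd n then 3 else 4) \<le> t"
      by force
  qed
qed

end
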